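(* Assume the continuum hypothesis. Then there exist two downward-closed subsets of $[\omega]^\omega$, each of positive outer measure, whose intersection has measure zero.
   Context: Subsets of $\omega$ are identified with their characteristic functions in $2^\omega$, and $[\omega]^\omega \subseteq 2^\omega$ is the set of infinite subsets of $\omega$. For $x,y \subseteq \omega$, write $x \le y$ if $x - y$ is finite. A set $A \subseteq [\omega]^\omega$ is downward-closed if whenever $x \in A$, $y \in [\omega]^\omega$ and $y \le x$, then $y \in A$. Measure on $2^\omega$ is (the completion of) the product measure obtained from the uniform probability measure on $2=\{0,1\}$; outer measure refers to the associated outer measure. *)

theory Defs
  imports "HOL-Probability.Probability"
begin

text \<open>
  The continuum hypothesis in the form \<open>2\<^sup>\<aleph>\<^sup>0 = \<aleph>\<^sub>1\<close>: the power set of \<open>\<omega>\<close> is equipotent to the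
  successor cardinal of \<open>\<omega>\<close>.
\<close>

definition continuum_hypothesis :: bool
  where "continuum_hypothesis \<longleftrightarrow> (card_of (UNIV :: nat set set), cardSuc natLeq) \<in> ordIso"

definition infinite_subsets :: "nat set set"
  where "infinite_subsets = {x. infinite x}"

definition almost_subset :: "nat set \<Rightarrow> nat set \<Rightarrow> bool"  (infix \<open>\<le>*\<close> 50)
  where "x \<le>* y \<longleftrightarrow> finite (x - y)"

definition downward_closed :: "nat set set \<Rightarrow> bool"
  where "downward_closed A \<longleftrightarrow>
    A \<subseteq> infinite_subsets \<and> (\<forall>x\<in>A. \<forall>y\<in>infinite_subsets. y \<le>* x \<longrightarrow> y \<in> A)"

definition cantor_measure :: "(nat \<Rightarrow> bool) measure"
  where "cantor_measure =
    completion (\<Pi>\<^sub>M n\<in>UNIV. uniform_count_measure (UNIV :: bool set))"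

definition char_fun :: "nat set \<Rightarrow> nat \<Rightarrow> bool"
  where "char_fun x = (\<lambda>n. n \<in> x)"

lemma bij_char_fun: "bij char_fun"
  by (rule bij_betw_byWitness[where f' = Collect]) (auto simp: char_fun_def)

lemma space_cantor_measure: "space cantor_measure = UNIV"
  by (simp add: cantor_measure_def space_PiM space_uniform_count_measure)

lemma prob_space_cantor_measure: "prob_space cantor_measure"
  unfolding cantor_measure_def
  by (intro prob_space.prob_space_completion prob_space_PiM prob_space_uniform_count_measure) auto

end

theory Submission
  imports Defs "HOL-Library.Countable_Set_Type"
begin

text \<open>
  Take \<open>3\<^sup>k\<close> disjoint blocks of length \<open>2k\<close> above \<open>k\<close>, for each \<open>k\<close>. A random set misses a given block
  with probability \<open>4\<^sup>-\<^sup>k\<close>, and \<open>\<Sum> 3\<^sup>k 4\<^sup>-\<^sup>k < \<infinity>\<close>, so the family \<open>N\<close> of sets missing a block at infinitely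
  many levels is null. The intersection of two independent random sets misses a given block with
  probability \<open>(9/16)\<^sup>k\<close>, and \<open>3\<^sup>k (9/16)\<^sup>k \<rightarrow> \<infinity>\<close>, so \<open>a \<inter> b \<in> N\<close> for almost every \<open>a\<close> and almost every \<open>b\<close>.
  Under CH a transfinite recursion of length \<open>\<omega>\<^sub>1\<close> yields two non-null sequences \<open>a\<^sub>s\<close>, \<open>b\<^sub>t\<close> with
  \<open>a\<^sub>s \<inter> b\<^sub>t \<in> N\<close> for all \<open>s, t\<close>. As \<open>N\<close> is closed under almost-subsets, it contains the intersection
  of their downward closures.
\<close>

section \<open>Fair coin tossing on the product sigma-algebra\<close>

text \<open>The measure before completion: concrete events are handled on the product sigma-algebra,
  and the completion returns only in the last two results.\<close>

definition coin :: "(nat \<Rightarrow> bool) measure"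
  where "coin = (\<Pi>\<^sub>M n\<in>UNIV. uniform_count_measure (UNIV :: bool set))"

lemma cantor_measure_eq: "cantor_measure = completion coin"
  by (simp add: cantor_measure_def coin_def)

lemma space_coin [simp]: "space coin = UNIV"
  by (simp add: coin_def space_PiM space_uniform_count_measure)

interpretation coin: prob_space coin
  unfolding coin_def by (intro prob_space_PiM prob_space_uniform_count_measure) auto

lemma measurable_coin_component [measurable]: "(\<lambda>x. x i) \<in> coin \<rightarrow>\<^sub>M count_space UNIV"
proof -
  have "(\<lambda>x. x i) \<in> coin \<rightarrow>\<^sub>M uniform_count_measure (UNIV :: bool set)"
    unfolding coin_def by measurable
  then show ?thesis
    by (simp add: measurable_def space_uniform_count_measure sets_uniform_count_measure)
qed

lemma sets_coin_Collect: "Measurable.pred coin P \<Longrightarrow> {x. P x} \<in> sets coin"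
  by (simp add: pred_def)

lemma measurable_coin_comp [measurable]: "(\<lambda>x. f (x i) :: real) \<in> borel_measurable coin"
  by (rule measurable_compose[OF measurable_coin_component]) simp

subsection \<open>Products over coordinates and blocks\<close>

text \<open>The integrand depends only on the coordinates in \<open>L\<close>, so the integral can
  be computed on the finite product over \<open>L\<close>, where Fubini splits it into averages over
  the two values.\<close>

lemma coin_integral_prod:
  fixes \<phi> :: "nat \<Rightarrow> bool \<Rightarrow> real"
  assumes "finite L"
  shows "(\<integral>x. (\<Prod>i\<in>L. \<phi> i (x i)) \<partial>coin) = (\<Prod>i\<in>L. (\<phi> i True + \<phi> i False) / 2)"
proof -
  define U where "U = uniform_count_measure (UNIV :: bool set)"
  interpret U: prob_space U
    unfolding U_def by (rule prob_space_uniform_count_measure) auto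
  interpret P: product_prob_space "\<lambda>_::nat. U" UNIV
    by standard
  have fin: "(\<integral>x. f x \<partial>U) = (f True + f False) / 2" for f :: "bool \<Rightarrow> real"
    unfolding U_def by (subst integral_uniform_count_measure) (auto simp: UNIV_bool)
  have int: "integrable U f" for f :: "bool \<Rightarrow> real"
  proof (rule U.integrable_const_bound)
    have "\<bar>f b\<bar> \<le> max \<bar>f True\<bar> \<bar>f False\<bar>" for b by (cases b) auto
    then show "AE b in U. norm (f b) \<le> max \<bar>f True\<bar> \<bar>f False\<bar>" by simp
  qed (simp add: U_def measurable_def space_uniform_count_measure sets_uniform_count_measure)
  have meas: "(\<lambda>x. \<Prod>i\<in>L. \<phi> i (x i)) \<in> borel_measurable (\<Pi>\<^sub>M i\<in>L. U)"
  proof (intro borel_measurable_prod)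
    fix i assume "i \<in> L"
    then show "(\<lambda>x. \<phi> i (x i)) \<in> borel_measurable (\<Pi>\<^sub>M i\<in>L. U)"
      by (intro measurable_compose[OF measurable_component_singleton])
         (auto simp: U_def measurable_def space_uniform_count_measure sets_uniform_count_measure)
  qed
  have "(\<integral>x. (\<Prod>i\<in>L. \<phi> i (x i)) \<partial>coin) = (\<integral>x. (\<Prod>i\<in>L. \<phi> i (restrict x L i)) \<partial>coin)"
    by (intro Bochner_Integration.integral_cong) auto
  also have "\<dots> = (\<integral>x. (\<Prod>i\<in>L. \<phi> i (x i)) \<partial>distr coin (\<Pi>\<^sub>M i\<in>L. U) (\<lambda>x. restrict x L))"
    by (subst integral_distr) (auto simp: coin_def U_def[symmetric] meas measurable_restrict_subset)
  also have "distr coin (\<Pi>\<^sub>M i\<in>L. U) (\<lambda>x. restrict x L) = (\<Pi>\<^sub>M i\<in>L. U)"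
    unfolding coin_def U_def[symmetric] by (rule P.distr_PiM_restrict_finite[OF assms]) simp
  also have "(\<integral>x. (\<Prod>i\<in>L. \<phi> i (x i)) \<partial>(\<Pi>\<^sub>M i\<in>L. U)) = (\<Prod>i\<in>L. \<integral>x. \<phi> i x \<partial>U)"
    by (rule P.product_integral_prod) (auto simp: assms int)
  finally show ?thesis by (simp add: fin)
qed

lemma prod_of_bool:
  "finite A \<Longrightarrow> (\<Prod>i\<in>A. of_bool (P i)) = (of_bool (\<forall>i\<in>A. P i) :: 'a::comm_semiring_1)"
  by (induction A rule: finite_induct) auto

text \<open>The extra product over \<open>L\<close> makes the induction on \<open>J\<close> go
  through: multiplying out the factor of a new block \<open>j\<close> gives a difference of two
  integrals of the same shape, one with \<open>L\<close> and one with \<open>I j \<union> L\<close>.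
  The bounds on \<open>\<phi>\<close> give integrability.\<close>

lemma coin_integral_blocks_aux:
  fixes \<phi> :: "nat \<Rightarrow> bool \<Rightarrow> real"
  assumes "finite J" "\<And>j. finite (I j)" "disjoint_family_on I J"
    and "finite L" "\<And>j. j \<in> J \<Longrightarrow> I j \<inter> L = {}"
    and \<phi>: "\<And>i b. 0 \<le> \<phi> i b" "\<And>i b. \<phi> i b \<le> 1"
  shows "(\<integral>x. (\<Prod>j\<in>J. 1 - (\<Prod>i\<in>I j. \<phi> i (x i))) * (\<Prod>i\<in>L. \<phi> i (x i)) \<partial>coin) =
    (\<Prod>j\<in>J. 1 - (\<Prod>i\<in>I j. (\<phi> i True + \<phi> i False) / 2)) * (\<Prod>i\<in>L. (\<phi> i True + \<phi> i False) / 2)"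
  using assms(1,3,4,5)
proof (induction J arbitrary: L rule: finite_induct)
  case empty
  then show ?case by (simp add: coin_integral_prod)
next
  case (insert j J)
  let ?P = "\<lambda>x. \<Prod>j\<in>J. 1 - (\<Prod>i\<in>I j. \<phi> i (x i))"
  let ?Q = "\<lambda>L x. \<Prod>i\<in>L. \<phi> i (x i)"
  let ?q = "\<lambda>L. \<Prod>i\<in>L. (\<phi> i True + \<phi> i False) / 2"
  have Q: "0 \<le> ?Q L x" "?Q L x \<le> 1" for L x
    using \<phi> by (auto intro!: prod_nonneg prod_le_1)
  then have P: "0 \<le> ?P x" "?P x \<le> 1" for x
    by (auto intro!: prod_nonneg prod_le_1)
  have int: "integrable coin (\<lambda>x. ?P x * ?Q L x)" for L
    by (rule coin.integrable_const_bound[where B=1]) (auto simp: abs_mult abs_of_nonneg[OF P(1)] abs_of_nonneg[OF Q(1)] intro!: mult_le_one P Q)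
  have disj: "disjoint_family_on I J" "I j \<inter> L = {}"
    using insert.prems by (auto simp: disjoint_family_on_def)
  have Ij: "I j' \<inter> (I j \<union> L) = {}" if "j' \<in> J" for j'
  proof -
    have "j' \<noteq> j" using that insert.hyps by auto
    with that insert.prems(1) have "I j' \<inter> I j = {}" by (auto simp: disjoint_family_on_def)
    with insert.prems(3)[of j'] that show ?thesis by auto
  qed
  have "(\<Prod>j\<in>insert j J. 1 - (\<Prod>i\<in>I j. \<phi> i (x i))) * ?Q L x = ?P x * ?Q L x - ?P x * ?Q (I j \<union> L) x" for x
    using insert.hyps disj insert.prems(2) assms(2)
    by (simp add: prod.union_disjoint algebra_simps)
  then have "(\<integral>x. (\<Prod>j\<in>insert j J. 1 - (\<Prod>i\<in>I j. \<phi> i (x i))) * ?Q L x \<partial>coin) =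
     (\<integral>x. ?P x * ?Q L x \<partial>coin) - (\<integral>x. ?P x * ?Q (I j \<union> L) x \<partial>coin)"
    by (simp add: int)
  also have "\<dots> = (\<Prod>j\<in>J. 1 - ?q (I j)) * ?q L - (\<Prod>j\<in>J. 1 - ?q (I j)) * ?q (I j \<union> L)"
    using insert.IH[OF disj(1), of L] insert.IH[OF disj(1), of "I j \<union> L"] insert.prems Ij assms(2) by simp
  also have "?q (I j \<union> L) = ?q (I j) * ?q L"
    by (rule prod.union_disjoint) (use disj insert.prems assms(2) in auto)
  finally show ?case
    using insert.hyps by (simp add: algebra_simps)
qed

lemma coin_integral_blocks:
  fixes \<phi> :: "nat \<Rightarrow> bool \<Rightarrow> real"
  assumes "finite J" "\<And>j. finite (I j)" "disjoint_family_on I J"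
    and "\<And>i b. 0 \<le> \<phi> i b" "\<And>i b. \<phi> i b \<le> 1"
  shows "(\<integral>x. (\<Prod>j\<in>J. 1 - (\<Prod>i\<in>I j. \<phi> i (x i))) \<partial>coin) =
    (\<Prod>j\<in>J. 1 - (\<Prod>i\<in>I j. (\<phi> i True + \<phi> i False) / 2))"
  using coin_integral_blocks_aux[OF assms(1-3), where L="{}" and \<phi>=\<phi>] assms(4,5) by simp

subsection \<open>Sets with infinitely many gaps\<close>

definition block :: "nat \<Rightarrow> nat \<Rightarrow> nat set"
  where "block k j = {k + 2 * k * j ..< k + 2 * k * j + 2 * k}"

definition gap_at :: "nat \<Rightarrow> (nat \<Rightarrow> bool) \<Rightarrow> bool"
  where "gap_at k x \<longleftrightarrow> (\<exists>j<3 ^ k. \<forall>i\<in>block k j. \<not> x i)"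

definition gappy :: "(nat \<Rightarrow> bool) \<Rightarrow> bool"
  where "gappy x \<longleftrightarrow> (\<exists>\<^sub>\<infinity>k. gap_at k x)"

lemma finite_block [simp]: "finite (block k j)"
  by (simp add: block_def)

lemma card_block [simp]: "card (block k j) = 2 * k"
  by (simp add: block_def)

lemma disjoint_block: "disjoint_family_on (block k) J"
proof -
  have "block k i \<inter> block k j = {}" if "i < j" for i j
  proof -
    have "2 * k * (i + 1) \<le> 2 * k * j" using that by (intro mult_le_mono) auto
    then show ?thesis by (auto simp: block_def)
  qed
  then show ?thesis
    unfolding disjoint_family_on_def by (metis inf_commute linorder_neqE_nat)
qed

lemma gap_at_measurable [measurable]: "Measurable.pred coin (gap_at k)"
  unfolding gap_at_def by measurable

lemma gap_at_and_measurable [measurable]: "Measurable.pred coin (\<lambda>x. gap_at k (\<lambda>i. a i \<and> x i))"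
  unfolding gap_at_def by measurable

lemma gappy_measurable [measurable]: "Measurable.pred coin gappy"
  unfolding gappy_def INFM_nat by measurable

text \<open>Blocks of level \<open>k\<close> contain only numbers \<open>\<ge> k\<close>. Once
  \<open>k\<close> exceeds all exceptions, every gap of \<open>x\<close> at level \<open>k\<close>
  is also a gap of \<open>y\<close>.\<close>

lemma gappy_mono:
  assumes "gappy x" "finite {i. y i \<and> \<not> x i}"
  shows "gappy y"
proof -
  obtain m where m: "\<And>i. y i \<Longrightarrow> \<not> x i \<Longrightarrow> i < m"
    using assms(2) by (auto simp: finite_nat_set_iff_bounded)
  show ?thesis
    unfolding gappy_def INFM_nat
  proof
    fix n
    obtain k where k: "k > max n m" "gap_at k x"
      using assms(1) unfolding gappy_def INFM_nat by blast
    then obtain j where j: "j < 3 ^ k" "\<forall>i\<in>block k j. \<not> x i"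
      unfolding gap_at_def by blast
    have "\<not> y i" if "i \<in> block k j" for i
      using m[of i] that j k(1) by (auto simp: block_def)
    with j k(1) show "\<exists>k>n. gap_at k y"
      unfolding gap_at_def by auto
  qed
qed

lemma finite_gappy:
  assumes "finite {i. x i}"
  shows "gappy x"
proof (rule gappy_mono)
  show "gappy (\<lambda>_. False)"
    unfolding gappy_def gap_at_def INFM_nat by (metis lessI zero_less_numeral zero_less_power)
qed (use assms in simp)

section \<open>Gap probabilities for a random set and for an intersection\<close>

lemma prob_block_empty: "coin.prob {x. \<forall>i\<in>block k j. \<not> x i} = (1/4) ^ k"
proof -
  have "coin.prob {x. \<forall>i\<in>block k j. \<not> x i} = (\<integral>x. indicator {x. \<forall>i\<in>block k j. \<not> x i} x \<partial>coin)"
    by simp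
  also have "\<dots> = (\<integral>x. (\<Prod>i\<in>block k j. of_bool (\<not> x i)) \<partial>coin)"
    by (intro Bochner_Integration.integral_cong) (auto simp: indicator_def)
  also have "\<dots> = (1/4) ^ k"
    by (subst coin_integral_prod[where \<phi>="\<lambda>_ b. of_bool (\<not> b)"]) (simp_all add: power_mult power2_eq_square power_divide)
  finally show ?thesis .
qed

text \<open>The union bound over the \<open>3 ^ k\<close> blocks gives at most
  \<open>(3/4) ^ k\<close> at level \<open>k\<close>, which is summable, so Borel-Cantelli
  applies.\<close>

lemma gappy_null: "{x. gappy x} \<in> null_sets coin"
proof -
  have "coin.prob {x. gap_at k x} \<le> (3/4) ^ k" for k
  proof -
    have "{x. gap_at k x} = (\<Union>j<3^k. {x. \<forall>i\<in>block k j. \<not> x i})"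
      by (auto simp: gap_at_def)
    also have "coin.prob \<dots> \<le> (\<Sum>j<3^k. coin.prob {x. \<forall>i\<in>block k j. \<not> x i})"
      by (rule coin.finite_measure_subadditive_finite) (auto intro!: sets_coin_Collect)
    finally show ?thesis by (simp add: prob_block_empty power_divide)
  qed
  then have "summable (\<lambda>k. coin.prob {x. gap_at k x})"
    by (intro summable_comparison_test[OF _ summable_geometric[of "3/4::real"]]) auto
  then have "AE x in coin. eventually (\<lambda>k. x \<in> space coin - {x. gap_at k x}) sequentially"
    by (intro borel_cantelli_AE1) (auto simp: less_top[symmetric] intro!: sets_coin_Collect)
  then have "AE x in coin. \<not> gappy x"
    by (simp add: gappy_def frequently_def cofinite_eq_sequentially)
  then show ?thesis
    by (subst (asm) AE_iff_null) (auto intro: sets_coin_Collect)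
qed

text \<open>Conditioning on \<open>a\<close>, the empty blocks of \<open>a \<inter> b\<close> at level \<open>k\<close> are independent events.\<close>

definition miss :: "nat \<Rightarrow> (nat \<Rightarrow> bool) \<Rightarrow> real"
  where "miss k a = (\<Prod>j<3^k. 1 - (\<Prod>i\<in>block k j. if a i then 1/2 else 1))"

lemma miss_bounds: "0 \<le> miss k a" "miss k a \<le> 1"
  unfolding miss_def by (auto intro!: prod_nonneg prod_le_1)

lemma miss_measurable [measurable]: "miss k \<in> borel_measurable coin"
proof -
  have "(\<lambda>x. if x i then 1/2 else 1 :: real) \<in> borel_measurable coin" for i
    by (rule measurable_coin_comp[where f="\<lambda>b. if b then 1/2 else 1"])
  then show ?thesis unfolding miss_def[abs_def] by measurable
qed

text \<open>Within a block only the coordinates in \<open>a\<close> constrain \<open>b\<close>, and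
  each is avoided with probability 1/2. One minus the product of the avoidance indicators is the
  indicator that the block is hit.\<close>

lemma prob_no_gap: "coin.prob {b. \<not> gap_at k (\<lambda>i. a i \<and> b i)} = miss k a"
proof -
  have "coin.prob {b. \<not> gap_at k (\<lambda>i. a i \<and> b i)} = (\<integral>b. indicator {b. \<not> gap_at k (\<lambda>i. a i \<and> b i)} b \<partial>coin)"
    by simp
  also have "\<dots> = (\<integral>b. (\<Prod>j<3^k. 1 - (\<Prod>i\<in>block k j. of_bool (\<not> (a i \<and> b i)))) \<partial>coin)"
    by (intro Bochner_Integration.integral_cong) (auto simp: indicator_def gap_at_def prod_of_bool simp flip: of_bool_not_iff)
  also have "\<dots> = miss k a"
    unfolding miss_def
    by (subst coin_integral_blocks[where \<phi>="\<lambda>i b. of_bool (\<not> (a i \<and> b))"])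
       (auto simp: disjoint_block intro!: prod.cong arg_cong[where f="\<lambda>x. 1 - x"])
  finally show ?thesis .
qed

text \<open>Averaging over \<open>a\<close> gives (1/2 + 1)/2 = 3/4 per coordinate, hence 9/16 to
  the power \<open>k\<close> for a block of length \<open>2 * k\<close>.\<close>

lemma expectation_miss: "(\<integral>a. miss k a \<partial>coin) = (1 - (9/16) ^ k) ^ (3 ^ k)"
  unfolding miss_def
  by (subst coin_integral_blocks[where \<phi>="\<lambda>i b. if b then 1/2 else 1"])
     (auto simp: disjoint_block power_mult power2_eq_square)

lemma expectation_miss_tendsto: "(\<lambda>k. \<integral>a. miss k a \<partial>coin) \<longlonglongrightarrow> 0"
proof (rule tendsto_sandwich)
  show "\<forall>\<^sub>F k in sequentially. 0 \<le> (\<integral>a. miss k a \<partial>coin)"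
    by (simp add: miss_bounds)
  show "(\<lambda>k. (16/27) ^ k :: real) \<longlonglongrightarrow> 0"
    by (rule LIMSEQ_realpow_zero) auto
  \<comment> \<open>With y = (27/16)^k, the bound 1 - t \<le> exp(-t) gives exp(-y), and exp(y)
    \<ge> y turns this into 1/y.\<close>
  have "(1 - (9/16) ^ k :: real) ^ (3 ^ k) \<le> (16/27) ^ k" for k
  proof -
    have "(1 - (9/16) ^ k :: real) ^ (3 ^ k) \<le> exp (- ((9/16) ^ k)) ^ (3 ^ k)"
      using exp_ge_add_one_self[of "- ((9/16) ^ k :: real)"] by (intro power_mono) (auto simp: power_le_one)
    also have "\<dots> = exp (- ((27/16) ^ k))"
      by (simp add: exp_of_nat_mult[symmetric] power_mult_distrib[symmetric])
    also have "\<dots> = 1 / exp ((27/16) ^ k)"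
      by (simp add: exp_minus field_simps)
    also have "\<dots> \<le> 1 / (27/16) ^ k"
    proof (rule divide_left_mono)
      show "(27/16 :: real) ^ k \<le> exp ((27/16) ^ k)"
        using exp_ge_add_one_self[of "(27/16 :: real) ^ k"] by linarith
    qed auto
    finally show ?thesis by (simp add: power_divide)
  qed
  then show "\<forall>\<^sub>F k in sequentially. (\<integral>a. miss k a \<partial>coin) \<le> (16/27) ^ k"
    by (simp add: expectation_miss)
qed simp

lemma AE_AE_gappy: "AE a in coin. AE b in coin. gappy (\<lambda>i. a i \<and> b i)"
proof -
  \<comment> \<open>Fatou's lemma: the expectations tend to 0, so the lower limit of
    \<open>miss k a\<close> vanishes for almost every \<open>a\<close>.\<close>
  have "(\<integral>\<^sup>+a. liminf (\<lambda>k. ennreal (miss k a)) \<partial>coin) \<le> liminf (\<lambda>k. \<integral>\<^sup>+a. ennreal (miss k a) \<partial>coin)"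
    by (rule nn_integral_liminf) simp
  also have "(\<lambda>k. \<integral>\<^sup>+a. ennreal (miss k a) \<partial>coin) = (\<lambda>k. ennreal (\<integral>a. miss k a \<partial>coin))"
    by (intro ext nn_integral_eq_integral coin.integrable_const_bound[where B=1]) (auto simp: miss_bounds)
  also have "liminf \<dots> = 0"
    using tendsto_ennrealI[OF expectation_miss_tendsto] by (intro lim_imp_Liminf) auto
  finally have "AE a in coin. liminf (\<lambda>k. ennreal (miss k a)) = 0"
    by (simp add: nn_integral_0_iff_AE)
  then show ?thesis
  proof eventually_elim
    case (elim a)
    have "AE b in coin. \<not> (\<forall>k>n. \<not> gap_at k (\<lambda>i. a i \<and> b i))" for n
    proof -
      let ?S = "{b. \<forall>k>n. \<not> gap_at k (\<lambda>i. a i \<and> b i)}"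
      \<comment> \<open>Having no gap beyond \<open>n\<close> implies having none at each single
        level \<open>k > n\<close>, so the measure is below every such \<open>miss k a\<close>,
        hence below their lower limit.\<close>
      have "emeasure coin ?S \<le> (INF k\<in>{Suc n..}. ennreal (miss k a))"
      proof (rule INF_greatest)
        fix k assume "k \<in> {Suc n..}"
        then have "emeasure coin ?S \<le> emeasure coin {b. \<not> gap_at k (\<lambda>i. a i \<and> b i)}"
          by (intro emeasure_mono sets_coin_Collect) auto
        then show "emeasure coin ?S \<le> ennreal (miss k a)"
          by (simp add: coin.emeasure_eq_measure prob_no_gap)
      qed
      also have "\<dots> \<le> liminf (\<lambda>k. ennreal (miss k a))"
        unfolding liminf_SUP_INF by (rule SUP_upper) simp
      finally have "emeasure coin ?S = 0" using elim by simp
      then have "?S \<in> null_sets coin" by (intro null_setsI sets_coin_Collect) auto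
      then show ?thesis by (subst AE_iff_null) auto
    qed
    then have "AE b in coin. \<forall>n. \<not> (\<forall>k>n. \<not> gap_at k (\<lambda>i. a i \<and> b i))"
      by (simp add: AE_all_countable)
    then show ?case by (simp add: gappy_def INFM_nat)
  qed
qed

subsection \<open>Coding null sets by subsets of the natural numbers\<close>

text \<open>A set of naturals codes the union of the basic open sets whose indices it contains, for
  an enumeration of a countable basis.\<close>

lemma open_sets_coded:
  "\<exists>e :: nat set \<Rightarrow> 'a::second_countable_topology set. \<forall>U. open U \<longrightarrow> U \<in> range e"
proof -
  obtain B :: "'a set set" where B: "countable B" "topological_basis B"
    using ex_countable_basis by blast
  show ?thesis
  proof (intro exI[of _ "\<lambda>s. \<Union> (from_nat_into B ` s)"] allI impI)
    fix U :: "'a set" assume "open U"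
    then obtain B' where B': "B' \<subseteq> B" "\<Union>B' = U"
      using B(2) by (auto simp: topological_basis_def)
    have "from_nat_into B ` (to_nat_on B ` B') = B'"
      using B'(1) B(1) by (force simp: image_image subset_iff)
    then show "U \<in> range (\<lambda>s. \<Union> (from_nat_into B ` s))"
      using B'(2) by (metis rangeI)
  qed
qed

text \<open>\<open>outer_regular\<close> needs class \<open>complete_space\<close>, of which \<open>bool\<close> is no instance, so the measure is
  pushed forward to \<open>nat \<Rightarrow> real\<close>.\<close>

lemma coin_null_outer_approx:
  assumes "N \<in> null_sets coin" "0 < (\<epsilon> :: ennreal)"
  shows "\<exists>U :: (nat \<Rightarrow> real) set. open U \<and> N \<subseteq> {x. (\<lambda>i. of_bool (x i)) \<in> U} \<and>
    emeasure coin {x. (\<lambda>i. of_bool (x i)) \<in> U} < \<epsilon>"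
proof -
  define h :: "(nat \<Rightarrow> bool) \<Rightarrow> nat \<Rightarrow> real" where "h x = (\<lambda>i. of_bool (x i))" for x
  define g :: "(nat \<Rightarrow> real) \<Rightarrow> nat \<Rightarrow> bool" where "g y = (\<lambda>i. y i > 1/2)" for y
  have gh: "g (h x) = x" for x by (auto simp: g_def h_def)
  have h [measurable]: "h \<in> coin \<rightarrow>\<^sub>M borel"
    unfolding h_def by (rule measurable_coordinatewise_then_product) simp
  have g: "g \<in> borel \<rightarrow>\<^sub>M coin"
    unfolding coin_def g_def
  proof (rule measurable_PiM_single')
    fix i :: nat
    have "(\<lambda>y. y i > 1/2) \<in> (borel :: (nat \<Rightarrow> real) measure) \<rightarrow>\<^sub>M count_space UNIV"
      using measurable_product_coordinates[of i, where 'b=real] by measurable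
    then show "(\<lambda>y. y i > 1/2) \<in> (borel :: (nat \<Rightarrow> real) measure) \<rightarrow>\<^sub>M uniform_count_measure UNIV"
      by (simp add: measurable_def space_uniform_count_measure sets_uniform_count_measure)
  qed (auto simp: space_uniform_count_measure)
  let ?D = "distr coin borel h"
  have N: "g -` N \<in> sets borel"
    using measurable_sets[OF g, of N] assms(1) by auto
  have "h -` (g -` N) = N"
    by (auto simp: gh)
  then have "emeasure ?D (g -` N) = 0"
    using assms(1) N h by (simp add: emeasure_distr null_sets_def)
  moreover have "emeasure ?D (g -` N) = (INF U\<in>{U. g -` N \<subseteq> U \<and> open U}. emeasure ?D U)"
    using N by (intro outer_regular) (auto simp: emeasure_distr h)
  ultimately have "(INF U\<in>{U. g -` N \<subseteq> U \<and> open U}. emeasure ?D U) < \<epsilon>"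
    using assms(2) by simp
  then obtain U where U: "g -` N \<subseteq> U" "open U" "emeasure ?D U < \<epsilon>"
    by (auto simp: INF_less_iff)
  have "N \<subseteq> h -` U"
    using U(1) gh by (auto simp: subset_iff)
  moreover have "emeasure coin (h -` U) < \<epsilon>"
    using U(2,3) h by (simp add: emeasure_distr)
  ultimately show ?thesis
    using U(2) by (intro exI[of _ U]) (simp add: h_def vimage_def)
qed

text \<open>Every null set lies in a null intersection of countably many preimages of open sets. The
  countably many codes are packed into one subset of the naturals, so the null sets have a cofinal
  family indexed by \<open>nat set\<close>.\<close>

lemma null_sets_coin_coded:
  "\<exists>C :: nat set \<Rightarrow> (nat \<Rightarrow> bool) set.
    (\<forall>s. C s \<in> null_sets coin) \<and> (\<forall>N\<in>null_sets coin. \<exists>s. N \<subseteq> C s)"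
proof -
  obtain e :: "nat set \<Rightarrow> (nat \<Rightarrow> real) set" where e: "\<And>U. open U \<Longrightarrow> U \<in> range e"
    using open_sets_coded by blast
  define h :: "(nat \<Rightarrow> bool) \<Rightarrow> nat \<Rightarrow> real" where "h x = (\<lambda>i. of_bool (x i))" for x
  have h: "h \<in> coin \<rightarrow>\<^sub>M borel"
    unfolding h_def by (rule measurable_coordinatewise_then_product) simp
  define D where "D s = (\<Inter>k. h -` e {n. prod_encode (k, n) \<in> s})" for s
  \<comment> \<open>Codes of non-null intersections are sent to the empty set, so that every
    \<open>C s\<close> is null.\<close>
  define C where "C s = (if D s \<in> null_sets coin then D s else {})" for s
  have "\<exists>s. N \<subseteq> C s" if N: "N \<in> null_sets coin" for N
  proof -
    have "\<forall>k. \<exists>U. open U \<and> N \<subseteq> h -` U \<and> emeasure coin (h -` U) < ennreal (inverse (real (Suc k)))"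
      using coin_null_outer_approx[OF N] by (auto simp: h_def vimage_def)
    then obtain U where U: "\<And>k. open (U k)" "\<And>k. N \<subseteq> h -` U k"
        "\<And>k. emeasure coin (h -` U k) < ennreal (inverse (real (Suc k)))"
      by metis
    have "\<forall>k. \<exists>t. U k = e t"
      using e[OF U(1)] by blast
    then obtain t where t: "\<And>k. U k = e (t k)"
      by metis
    define s where "s = {prod_encode (k, n) | k n. n \<in> t k}"
    have "{n. prod_encode (k, n) \<in> s} = t k" for k
      by (auto simp: s_def)
    then have D: "D s = (\<Inter>k. h -` U k)"
      by (simp add: D_def t)
    have meas: "h -` U k \<in> sets coin" for k
      using measurable_sets[OF h, of "U k"] U(1)[of k] by simp
    have "D s \<in> sets coin"
      unfolding D using meas by auto
    moreover have "emeasure coin (D s) \<le> 0"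
    proof (rule LIMSEQ_le_const)
      show "(\<lambda>k. ennreal (inverse (real (Suc k)))) \<longlonglongrightarrow> 0"
        using tendsto_ennrealI[OF LIMSEQ_inverse_real_of_nat] by simp
      have "emeasure coin (D s) \<le> ennreal (inverse (real (Suc k)))" for k
      proof -
        have "emeasure coin (D s) \<le> emeasure coin (h -` U k)"
          using meas[of k] by (intro emeasure_mono) (auto simp: D)
        with U(3)[of k] show ?thesis by simp
      qed
      then show "\<exists>n. \<forall>k\<ge>n. emeasure coin (D s) \<le> ennreal (inverse (real (Suc k)))"
        by blast
    qed
    ultimately have "D s \<in> null_sets coin"
      by (intro null_setsI) auto
    then show ?thesis
      using U(2) by (intro exI[of _ s]) (auto simp: C_def D)
  qed
  moreover have "C s \<in> null_sets coin" for s
    by (simp add: C_def)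
  ultimately show ?thesis by blast
qed

subsection \<open>The transfinite construction\<close>

text \<open>The order \<open>card_of UNIV\<close> has minimal type, so its proper initial segments
  are smaller than the continuum. Under CH that means below \<aleph>1, that is, countable.
  \<open>R\<close> is its strict part.\<close>

lemma CH_well_order:
  assumes "continuum_hypothesis"
  shows "\<exists>R :: (nat set \<times> nat set) set.
    wf R \<and> (\<forall>s. countable {t. (t, s) \<in> R}) \<and> (\<forall>s t. s = t \<or> (s, t) \<in> R \<or> (t, s) \<in> R)"
proof -
  let ?r = "card_of (UNIV :: nat set set)"
  have wo: "Well_order ?r" "Field ?r = UNIV"
    using card_of_Well_order[of "UNIV :: nat set set"] by (simp_all add: Field_card_of)
  have "countable (underS ?r s)" for s
  proof -
    have "(card_of (underS ?r s), ?r) \<in> ordLess"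
      by (rule card_of_underS[OF card_of_Card_order]) (simp add: Field_card_of)
    also have "(?r, cardSuc natLeq) \<in> ordIso"
      using assms by (simp add: continuum_hypothesis_def)
    finally show ?thesis
      by (simp add: countable_card_le_natLeq cardSuc_ordLeq_ordLess natLeq_Card_order card_of_Card_order)
  qed
  moreover have "underS ?r s = {t. (t, s) \<in> ?r - Id}" for s
    by (auto simp: underS_def)
  moreover have "wf (?r - Id)" and "total_on UNIV ?r"
    using wo by (auto simp: well_order_on_def linear_order_on_def)
  ultimately show ?thesis
    by (intro exI[of _ "?r - Id"]) (simp add: total_on_def; blast)
qed

text \<open>Stage \<open>s\<close> picks a pair outside \<open>C s\<close> compatible with all
  earlier pairs. Only countably many conditions arise, each true almost everywhere, so a choice
  exists. Avoiding every \<open>C s\<close> makes both sequences non-null.\<close>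

lemma CH_non_null_pair:
  assumes CH: "continuum_hypothesis"
  obtains a b :: "nat set \<Rightarrow> nat \<Rightarrow> bool"
    where "\<And>s. \<not> gappy (a s)" "\<And>s. \<not> gappy (b s)"
      "\<And>N. N \<in> null_sets coin \<Longrightarrow> \<exists>s. a s \<notin> N" "\<And>N. N \<in> null_sets coin \<Longrightarrow> \<exists>s. b s \<notin> N"
      "\<And>s t. gappy (\<lambda>i. a s i \<and> b t i)"
proof -
  obtain R :: "(nat set \<times> nat set) set" where R: "wf R" "\<And>s. countable {t. (t, s) \<in> R}"
      "\<And>s t. s = t \<or> (s, t) \<in> R \<or> (t, s) \<in> R"
    using CH_well_order[OF CH] by blast
  obtain C :: "nat set \<Rightarrow> (nat \<Rightarrow> bool) set"
    where C: "\<And>s. C s \<in> null_sets coin" "\<And>N. N \<in> null_sets coin \<Longrightarrow> \<exists>s. N \<subseteq> C s"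
    using null_sets_coin_coded by blast
  define G where "G a \<longleftrightarrow> (AE b in coin. gappy (\<lambda>i. a i \<and> b i))" for a
  \<comment> \<open>Requiring \<open>G\<close> of each chosen point keeps the recursion alive:
    almost every later choice has a gappy intersection with it.\<close>
  define ok where "ok s a \<longleftrightarrow> a \<notin> C s \<and> \<not> gappy a \<and> G a" for s a
  define P where "P f s p \<longleftrightarrow> ok s (fst p) \<and> ok s (snd p) \<and> gappy (\<lambda>i. fst p i \<and> snd p i) \<and>
      (\<forall>t. (t, s) \<in> R \<longrightarrow> gappy (\<lambda>i. fst p i \<and> snd (f t) i) \<and> gappy (\<lambda>i. fst (f t) i \<and> snd p i))"
    for f :: "nat set \<Rightarrow> (nat \<Rightarrow> bool) \<times> (nat \<Rightarrow> bool)" and s p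
  have AE_ok: "AE a in coin. ok s a" for s
    unfolding ok_def G_def
    using AE_not_in[OF C(1)[of s]] AE_not_in[OF gappy_null] AE_AE_gappy by eventually_elim simp
  have ex: "\<exists>x. Q x" if "AE x in coin. Q x" for Q :: "(nat \<Rightarrow> bool) \<Rightarrow> bool"
    using coin.AE_False eventually_mono[OF that, of "\<lambda>_. False"] by blast
  have "\<exists>f. \<forall>s. P f s (f s)"
  proof (rule dependent_wf_choice[OF R(1)])
    fix f g :: "nat set \<Rightarrow> (nat \<Rightarrow> bool) \<times> (nat \<Rightarrow> bool)" and s p
    assume "\<And>t. (t, s) \<in> R \<Longrightarrow> f t = g t"
    then show "P f s p = P g s p" by (simp add: P_def cong: imp_cong)
  next
    fix s and f :: "nat set \<Rightarrow> (nat \<Rightarrow> bool) \<times> (nat \<Rightarrow> bool)"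
    assume IH: "\<And>t. (t, s) \<in> R \<Longrightarrow> P f t (f t)"
    \<comment> \<open>The earlier second components come first in the conjunction because
      \<open>G\<close> is known for them; commutativity restores the order used in
      \<open>P\<close>.\<close>
    have "AE a in coin. \<forall>t\<in>{t. (t, s) \<in> R}. gappy (\<lambda>i. snd (f t) i \<and> a i)"
      using IH by (subst AE_ball_countable[OF R(2)]) (auto simp: P_def ok_def G_def)
    with AE_ok[of s] have "AE a in coin. ok s a \<and> (\<forall>t\<in>{t. (t, s) \<in> R}. gappy (\<lambda>i. snd (f t) i \<and> a i))"
      by eventually_elim simp
    from ex[OF this] obtain a where a: "ok s a" "\<And>t. (t, s) \<in> R \<Longrightarrow> gappy (\<lambda>i. snd (f t) i \<and> a i)"
      by auto
    have "AE b in coin. \<forall>t\<in>{t. (t, s) \<in> R}. gappy (\<lambda>i. fst (f t) i \<and> b i)"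
      using IH by (subst AE_ball_countable[OF R(2)]) (auto simp: P_def ok_def G_def)
    moreover have "AE b in coin. gappy (\<lambda>i. a i \<and> b i)"
      using a(1) by (simp add: ok_def G_def)
    ultimately have "AE b in coin. ok s b \<and> gappy (\<lambda>i. a i \<and> b i) \<and>
        (\<forall>t\<in>{t. (t, s) \<in> R}. gappy (\<lambda>i. fst (f t) i \<and> b i))"
      using AE_ok[of s] by eventually_elim simp
    from ex[OF this] obtain b where "ok s b" "gappy (\<lambda>i. a i \<and> b i)"
        "\<And>t. (t, s) \<in> R \<Longrightarrow> gappy (\<lambda>i. fst (f t) i \<and> b i)"
      by auto
    with a show "\<exists>p. P f s p"
      by (intro exI[of _ "(a, b)"]) (simp add: P_def conj_commute)
  qed
  then obtain f where f: "\<And>s. P f s (f s)"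
    by blast
  have C': "fst (f s) \<notin> C s" "snd (f s) \<notin> C s" for s
    using f[of s] by (auto simp: P_def ok_def)
  show thesis
  proof (rule that[of "\<lambda>s. fst (f s)" "\<lambda>s. snd (f s)"])
    show "\<not> gappy (fst (f s))" "\<not> gappy (snd (f s))" for s
      using f[of s] by (auto simp: P_def ok_def)
    show "\<exists>s. fst (f s) \<notin> N" "\<exists>s. snd (f s) \<notin> N" if "N \<in> null_sets coin" for N
      using C(2)[OF that] C' by (meson subsetD)+
    \<comment> \<open>For \<open>s = t\<close> the pair itself is compatible; otherwise the
      condition imposed at the later of the two stages applies.\<close>
    show "gappy (\<lambda>i. fst (f s) i \<and> snd (f t) i)" for s t
      using R(3)[of s t] f[of s] f[of t] by (auto simp: P_def)
  qed
qed

section \<open>Downward closures of the two sequences\<close>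

definition downward_closure :: "('a \<Rightarrow> nat \<Rightarrow> bool) \<Rightarrow> nat set set"
  where "downward_closure a = {x. infinite x \<and> (\<exists>s. x \<le>* {i. a s i})}"

lemma downward_closed_downward_closure: "downward_closed (downward_closure a)"
proof -
  have "z \<le>* y" if "z \<le>* x" "x \<le>* y" for x y z
    using that finite_subset[of "z - y" "(z - x) \<union> (x - y)"] by (auto simp: almost_subset_def)
  then show ?thesis
    unfolding downward_closed_def downward_closure_def infinite_subsets_def by blast
qed

text \<open>If the outer measure were 0, the image would lie in a \<open>coin\<close>-null set
  \<open>N\<close>. Some \<open>a s\<close> escapes \<open>N\<close>, yet it belongs to the image:
  finite sets are gappy, so \<open>a s\<close> is the characteristic function of an infinite
  set.\<close>

lemma outer_measure_downward_closure:
  assumes "\<And>N. N \<in> null_sets coin \<Longrightarrow> \<exists>s. a s \<notin> N" "\<And>s. \<not> gappy (a s)"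
  shows "outer_measure_of cantor_measure (char_fun ` downward_closure a) > 0"
proof (rule ccontr)
  assume *: "\<not> ?thesis"
  let ?A = "char_fun ` downward_closure a"
  obtain E where "E \<in> sets cantor_measure" "?A \<subseteq> E"
      "outer_measure_of cantor_measure ?A = emeasure cantor_measure E"
    using outer_measure_of_attain[of ?A cantor_measure] by (auto simp: space_cantor_measure)
  then have "E \<in> null_sets (completion coin)"
    using * by (auto simp: cantor_measure_eq null_sets_def)
  then obtain N where N: "N \<in> null_sets coin" "?A \<subseteq> N"
    using \<open>?A \<subseteq> E\<close> by (auto simp: null_sets_completion_iff2)
  obtain s where s: "a s \<notin> N"
    using assms(1)[OF N(1)] by blast
  have "{i. a s i} \<in> downward_closure a"
    using assms(2)[of s] finite_gappy[of "a s"]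
    by (auto simp: downward_closure_def almost_subset_def intro!: exI[of _ s])
  moreover have "char_fun {i. a s i} = a s"
    by (simp add: char_fun_def)
  ultimately have "a s \<in> ?A"
    by (metis imageI)
  with N(2) s show False by blast
qed

theorem theorem6:
  assumes "continuum_hypothesis"
  shows "\<exists>A B :: nat set set.
    downward_closed A \<and> downward_closed B \<and>
    outer_measure_of cantor_measure (char_fun ` A) > 0 \<and>
    outer_measure_of cantor_measure (char_fun ` B) > 0 \<and>
    char_fun ` (A \<inter> B) \<in> null_sets cantor_measure"
proof (rule CH_non_null_pair[OF assms])
  fix a b :: "nat set \<Rightarrow> nat \<Rightarrow> bool"
  assume ab: "\<And>s. \<not> gappy (a s)" "\<And>s. \<not> gappy (b s)"
      "\<And>N. N \<in> null_sets coin \<Longrightarrow> \<exists>s. a s \<notin> N" "\<And>N. N \<in> null_sets coin \<Longrightarrow> \<exists>s. b s \<notin> N"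
      "\<And>s t. gappy (\<lambda>i. a s i \<and> b t i)"
  have "char_fun ` (downward_closure a \<inter> downward_closure b) \<subseteq> {x. gappy x}"
  proof clarify
    fix x assume "x \<in> downward_closure a" "x \<in> downward_closure b"
    then obtain s t where "finite (x - {i. a s i})" "finite (x - {i. b t i})"
      by (auto simp: downward_closure_def almost_subset_def)
    then have "finite ((x - {i. a s i}) \<union> (x - {i. b t i}))"
      by simp
    then have "finite {i. char_fun x i \<and> \<not> (a s i \<and> b t i)}"
      by (rule rev_finite_subset) (auto simp: char_fun_def)
    then show "gappy (char_fun x)"
      by (rule gappy_mono[OF ab(5)])
  qed
  \<comment> \<open>In the completed measure every subset of the null set of gappy points is
    measurable and null.\<close>
  then have "char_fun ` (downward_closure a \<inter> downward_closure b) \<in> null_sets cantor_measure"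
    unfolding cantor_measure_eq null_sets_completion_iff2 using gappy_null by blast
  moreover have "outer_measure_of cantor_measure (char_fun ` downward_closure a) > 0"
    using ab(3,1) by (rule outer_measure_downward_closure)
  moreover have "outer_measure_of cantor_measure (char_fun ` downward_closure b) > 0"
    using ab(4,2) by (rule outer_measure_downward_closure)
  ultimately show ?thesis
    using downward_closed_downward_closure by blast
qed

end
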